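(* Let $X$ and $Y$ be linear spaces. A function $f:X\to Y$ satisfies $$3f(x+3y)-f(3x+y)=12[f(x+y)+f(x-y)]-16[f(x)+f(y)]+12f(2y)-4f(2x)$$ for all $x,y\in X$ if and only if there exist additive functions $A,H:X\to Y$ and cubic functions $C,G:X\to Y$ such that $f(x)=H(x)+G(x)$ for all $x\in X$, where $H(x)=A(2x)-8A(x)$ and $G(x)=C(2x)-2C(x)$ for all $x\in X$.
   Context: A function $g:X\to Y$ is called additive if $g(x+y)=g(x)+g(y)$ for all $x,y\in X$. A function $g:X\to Y$ is called cubic if it satisfies $g(x+2y)-3g(x+y)+3g(x)-g(x-y)=6g(y)$ for all $x,y\in X$. *)

theory Defs
  imports Main "HOL.Real_Vector_Spaces"
begin

definition additive_fun :: "('a::real_vector \<Rightarrow> 'b::real_vector) \<Rightarrow> bool" where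
  "additive_fun g \<longleftrightarrow> (\<forall>x y. g (x + y) = g x + g y)"

definition cubic_fun :: "('a::real_vector \<Rightarrow> 'b::real_vector) \<Rightarrow> bool" where
  "cubic_fun g \<longleftrightarrow> (\<forall>x y. g (x + 2 *\<^sub>R y) - 3 *\<^sub>R g (x + y) + 3 *\<^sub>R g x - g (x - y) = 6 *\<^sub>R g y)"

end

theory Submission
  imports Defs
begin

text \<open>
  Every solution is odd, and then \<open>g x = f (2 x) - 8 f x\<close> is additive: this is a rational linear
  combination of four instances of the equation. Hence \<open>g (2 x) = 2 g x\<close>, which says that
  \<open>h x = f (2 x) - 2 f x\<close> satisfies \<open>h (2 x) = 8 h x\<close>. Since \<open>h\<close> is again a solution, two
  more instances show that it is cubic, and \<open>f = (h - g) / 6\<close>. All these linear combinations are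
  computed after composing with a linear functional; linear functionals separate points.
\<close>

section \<open>Reduction to real-valued functions\<close>

definition mixed_fun :: "('a::real_vector \<Rightarrow> 'b::real_vector) \<Rightarrow> bool" where
  "mixed_fun f \<longleftrightarrow> (\<forall>x y. 3 *\<^sub>R f (x + 3 *\<^sub>R y) - f (3 *\<^sub>R x + y)
      = 12 *\<^sub>R (f (x + y) + f (x - y)) - 16 *\<^sub>R (f x + f y)
        + 12 *\<^sub>R f (2 *\<^sub>R y) - 4 *\<^sub>R f (2 *\<^sub>R x))"

text \<open>A nonzero vector is linearly independent on its own, so some linear functional takes the
  value 1 on it. Identities between vectors thereby become linear arithmetic over the reals, which
  simp can decide.\<close>

lemma eq_if_linear_functionals_eq:
  fixes v w :: "'a::real_vector"
  assumes "\<And>\<phi> :: 'a \<Rightarrow> real. linear \<phi> \<Longrightarrow> \<phi> v = \<phi> w"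
  shows "v = w"
proof (rule ccontr)
  assume "v \<noteq> w"
  then have "independent {v - w}"
    by simp
  then obtain \<phi> :: "'a \<Rightarrow> real" where "linear \<phi>" "\<forall>x\<in>{v - w}. \<phi> x = 1"
    using linear_independent_extend[of "{v - w}" "\<lambda>_. 1 :: real"] by blast
  then show False
    using assms[of \<phi>] by (simp add: linear_diff)
qed

lemmas linear_functional_simps = linear_add linear_diff linear_scale

text \<open>Additivity, cubicity and the mixed equation all equate linear combinations of values of
  the function. Linear functionals therefore preserve them, and separation of points gives the
  converse.\<close>

lemma additive_fun_iff_functionals:
  fixes g :: "'a::real_vector \<Rightarrow> 'b::real_vector"
  shows "additive_fun g \<longleftrightarrow> (\<forall>\<phi> :: 'b \<Rightarrow> real. linear \<phi> \<longrightarrow> additive_fun (\<lambda>x. \<phi> (g x)))"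
proof
  assume *: "\<forall>\<phi> :: 'b \<Rightarrow> real. linear \<phi> \<longrightarrow> additive_fun (\<lambda>x. \<phi> (g x))"
  have "g (x + y) = g x + g y" for x y
    by (rule eq_if_linear_functionals_eq) (use * in \<open>simp add: additive_fun_def linear_add\<close>)
  then show "additive_fun g"
    by (simp add: additive_fun_def)
qed (simp add: additive_fun_def linear_add)

lemma cubic_fun_iff_functionals:
  fixes g :: "'a::real_vector \<Rightarrow> 'b::real_vector"
  shows "cubic_fun g \<longleftrightarrow> (\<forall>\<phi> :: 'b \<Rightarrow> real. linear \<phi> \<longrightarrow> cubic_fun (\<lambda>x. \<phi> (g x)))"
proof (intro iffI allI impI)
  fix \<phi> :: "'b \<Rightarrow> real"
  assume "linear \<phi>" and "cubic_fun g"
  then have "\<phi> (g (x + 2 *\<^sub>R y) - 3 *\<^sub>R g (x + y) + 3 *\<^sub>R g x - g (x - y))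
      = \<phi> (6 *\<^sub>R g y)" for x y
    by (simp add: cubic_fun_def)
  with \<open>linear \<phi>\<close> show "cubic_fun (\<lambda>x. \<phi> (g x))"
    by (simp add: cubic_fun_def linear_functional_simps)
next
  assume *: "\<forall>\<phi> :: 'b \<Rightarrow> real. linear \<phi> \<longrightarrow> cubic_fun (\<lambda>x. \<phi> (g x))"
  have "g (x + 2 *\<^sub>R y) - 3 *\<^sub>R g (x + y) + 3 *\<^sub>R g x - g (x - y)
      = 6 *\<^sub>R g y" for x y
    by (rule eq_if_linear_functionals_eq) (use * in \<open>simp add: cubic_fun_def linear_functional_simps\<close>)
  then show "cubic_fun g"
    by (simp add: cubic_fun_def)
qed

lemma mixed_fun_iff_functionals:
  fixes g :: "'a::real_vector \<Rightarrow> 'b::real_vector"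
  shows "mixed_fun g \<longleftrightarrow> (\<forall>\<phi> :: 'b \<Rightarrow> real. linear \<phi> \<longrightarrow> mixed_fun (\<lambda>x. \<phi> (g x)))"
proof (intro iffI allI impI)
  fix \<phi> :: "'b \<Rightarrow> real"
  assume "linear \<phi>" and "mixed_fun g"
  then have "\<phi> (3 *\<^sub>R g (x + 3 *\<^sub>R y) - g (3 *\<^sub>R x + y))
      = \<phi> (12 *\<^sub>R (g (x + y) + g (x - y)) - 16 *\<^sub>R (g x + g y)
        + 12 *\<^sub>R g (2 *\<^sub>R y) - 4 *\<^sub>R g (2 *\<^sub>R x))" for x y
    by (simp add: mixed_fun_def)
  with \<open>linear \<phi>\<close> show "mixed_fun (\<lambda>x. \<phi> (g x))"
    by (simp add: mixed_fun_def linear_functional_simps)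
next
  assume *: "\<forall>\<phi> :: 'b \<Rightarrow> real. linear \<phi> \<longrightarrow> mixed_fun (\<lambda>x. \<phi> (g x))"
  have "3 *\<^sub>R g (x + 3 *\<^sub>R y) - g (3 *\<^sub>R x + y)
      = 12 *\<^sub>R (g (x + y) + g (x - y)) - 16 *\<^sub>R (g x + g y)
        + 12 *\<^sub>R g (2 *\<^sub>R y) - 4 *\<^sub>R g (2 *\<^sub>R x)" for x y
    by (rule eq_if_linear_functionals_eq) (use * in \<open>simp add: mixed_fun_def linear_functional_simps\<close>)
  then show "mixed_fun g"
    by (simp add: mixed_fun_def)
qed

section \<open>Cubic functions, and sums of additive and cubic functions as solutions\<close>

lemma cubic_fun_zero:
  fixes g :: "'a::real_vector \<Rightarrow> real"
  assumes "cubic_fun g"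
  shows "g 0 = 0"
  using assms[unfolded cubic_fun_def, rule_format, of 0 0] by simp

lemma cubic_fun_minus:
  fixes g :: "'a::real_vector \<Rightarrow> real"
  assumes "cubic_fun g"
  shows "g (- x) = - g x"
proof -
  note C = assms[unfolded cubic_fun_def, rule_format] and z = cubic_fun_zero[OF assms]
  have "- x - x = 2 *\<^sub>R (- x)"
    by (simp add: scaleR_2)
  then have "g x + 3 * g (- x) - g (2 *\<^sub>R (- x)) = 6 * g x"
    using C[of "- x" x] z by (simp add: scaleR_2)
  moreover have "g (2 *\<^sub>R (- x)) - 3 * g (- x) - g x = 6 * g (- x)"
    using C[of 0 "- x"] z by simp
  \<comment> \<open>In the sum of the two instances the left-hand sides cancel, leaving
    \<open>0 = 6 * g x + 6 * g (- x)\<close>.\<close>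
  ultimately show ?thesis
    by linarith
qed

lemma cubic_fun_double:
  fixes g :: "'a::real_vector \<Rightarrow> real"
  assumes "cubic_fun g"
  shows "g (2 *\<^sub>R x) = 8 * g x"
  using assms[unfolded cubic_fun_def, rule_format, of 0 x]
  by (simp add: cubic_fun_zero[OF assms] cubic_fun_minus[OF assms])

lemma mixed_fun_additive_plus_cubic:
  fixes h g :: "'a::real_vector \<Rightarrow> real"
  assumes "additive_fun h" "cubic_fun g"
  shows "mixed_fun (\<lambda>x. h x + g x)"
  unfolding mixed_fun_def
proof (intro allI)
  fix x y :: 'a
  note C = assms(2)[unfolded cubic_fun_def, rule_format]
  have add: "h (u + v) = h u + h v" for u v
    using assms(1) by (simp add: additive_fun_def)
  have sub: "h (u - v) = h u - h v" for u v
    using add[of "u - v" v] by simp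
  have two: "h (2 *\<^sub>R u) = 2 * h u" for u
    by (simp add: scaleR_2 add)
  have three: "h (3 *\<^sub>R u) = 3 * h u" for u
    using add[of u "2 *\<^sub>R u"] scaleR_left_distrib[of 1 2 u] by (simp add: two)
  \<comment> \<open>The instance at (u + v, v) plus three times the instance at (u, v) eliminates
    g(u + 2v).\<close>
  have shift: "g (u + 3 *\<^sub>R v) = 6 * g (u + v) - 8 * g u + 3 * g (u - v) + 24 * g v" for u v
  proof -
    have args: "u + v + 2 *\<^sub>R v = u + 3 *\<^sub>R v" "u + v + v = u + 2 *\<^sub>R v"
      using scaleR_left_distrib[of 1 2 v] by (simp_all add: scaleR_2 add.assoc)
    show ?thesis
      using C[of "u + v" v, unfolded args] C[of u v] by simp
  qed
  \<comment> \<open>Exchanging x and y in \<open>shift\<close> produces g(y - x), and oddness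
    changes it to -g(x - y).\<close>
  have "g (3 *\<^sub>R x + y) = 6 * g (x + y) - 8 * g y - 3 * g (x - y) + 24 * g x"
    using shift[of y x] cubic_fun_minus[OF assms(2), of "x - y"] by (simp add: add.commute)
  then show "3 *\<^sub>R (h (x + 3 *\<^sub>R y) + g (x + 3 *\<^sub>R y)) - (h (3 *\<^sub>R x + y) + g (3 *\<^sub>R x + y))
      = 12 *\<^sub>R (h (x + y) + g (x + y) + (h (x - y) + g (x - y)))
        - 16 *\<^sub>R (h x + g x + (h y + g y))
        + 12 *\<^sub>R (h (2 *\<^sub>R y) + g (2 *\<^sub>R y)) - 4 *\<^sub>R (h (2 *\<^sub>R x) + g (2 *\<^sub>R x))"
    using shift[of x y]
    by (simp add: cubic_fun_double[OF assms(2)] add sub two three)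
qed

section \<open>Additive and cubic components of a real-valued solution\<close>

lemma mixed_fun_minus:
  fixes f :: "'a::real_vector \<Rightarrow> real"
  assumes "mixed_fun f"
  shows "f (- x) = - f x"
proof -
  note E = assms[unfolded mixed_fun_def, rule_format]
  have "f 0 = 0"
    using E[of 0 0] by simp
  \<comment> \<open>Three times the instance at (x, 0) plus the instance at (0, x) eliminates both
    f(3x) and f(2x).\<close>
  then show ?thesis
    using E[of x 0] E[of 0 x] by simp
qed

text \<open>The instance at (x + y, -2x) minus three times the one at (2x, -x - y) eliminates f(5x -
  y) and f(4x), and so determines f(x + 3y) + 3 f(3x + y). The same sum is 3/4 of the instance at
  (x, y) plus 5/4 of the one at (y, x). On comparison f(x - y) cancels as well.\<close>

lemma mixed_fun_imp_additive:
  fixes f :: "'a::real_vector \<Rightarrow> real"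
  assumes "mixed_fun f"
  shows "additive_fun (\<lambda>x. f (2 *\<^sub>R x) - 8 * f x)"
  unfolding additive_fun_def
proof (intro allI)
  fix x y :: 'a
  \<comment> \<open>Indexing by coefficients turns vector arguments into pairs of numerals, which
    simp can evaluate and match.\<close>
  define F where "F i j = f (i *\<^sub>R x + j *\<^sub>R y)" for i j
  have E: "3 * F (a + 3 * c) (b + 3 * d) - F (3 * a + c) (3 * b + d)
      = 12 * (F (a + c) (b + d) + F (a - c) (b - d)) - 16 * (F a b + F c d)
        + 12 * F (2 * c) (2 * d) - 4 * F (2 * a) (2 * b)" for a b c d
    using assms[unfolded mixed_fun_def, rule_format, of "a *\<^sub>R x + b *\<^sub>R y" "c *\<^sub>R x + d *\<^sub>R y"]
    by (simp add: F_def algebra_simps)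
  \<comment> \<open>As rewrite rules, these make the first nonzero coefficient positive, so that
    values at opposite points are expressed by the same term.\<close>
  have neg: "F (- i) j = - F i (- j)" "F 0 (- j) = - F 0 j" for i j
    using mixed_fun_minus[OF assms, of "i *\<^sub>R x - j *\<^sub>R y"] mixed_fun_minus[OF assms, of "j *\<^sub>R y"]
    by (simp_all add: F_def)
  \<comment> \<open>The arguments are listed in the order \<open>a c b d\<close> in which they occur in \<open>E\<close>.\<close>
  have "F 2 2 - 8 * F 1 1 = F 2 0 - 8 * F 1 0 + (F 0 2 - 8 * F 0 1)"
    using E[of 1 "- 2" 1 0] E[of 2 "- 1" 0 "- 1"] E[of 1 0 0 1] E[of 0 1 1 0] by (simp add: neg)
  then show "f (2 *\<^sub>R (x + y)) - 8 * f (x + y)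
      = f (2 *\<^sub>R x) - 8 * f x + (f (2 *\<^sub>R y) - 8 * f y)"
    by (simp add: F_def algebra_simps)
qed

lemma mixed_fun_homogeneous_imp_cubic:
  fixes f :: "'a::real_vector \<Rightarrow> real"
  assumes "mixed_fun f" and double: "\<And>x. f (2 *\<^sub>R x) = 8 * f x"
  shows "cubic_fun f"
  unfolding cubic_fun_def
proof (intro allI)
  fix x y :: 'a
  define F where "F i j = f (i *\<^sub>R x + j *\<^sub>R y)" for i j
  have E: "3 * F (a + 3 * c) (b + 3 * d) - F (3 * a + c) (3 * b + d)
      = 12 * (F (a + c) (b + d) + F (a - c) (b - d)) - 16 * (F a b + F c d)
        + 12 * F (2 * c) (2 * d) - 4 * F (2 * a) (2 * b)" for a b c d
    using assms(1)[unfolded mixed_fun_def, rule_format, of "a *\<^sub>R x + b *\<^sub>R y" "c *\<^sub>R x + d *\<^sub>R y"]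
    by (simp add: F_def algebra_simps)
  have neg: "F (- i) j = - F i (- j)" "F 0 (- j) = - F 0 j" for i j
    using mixed_fun_minus[OF assms(1), of "i *\<^sub>R x - j *\<^sub>R y"]
      mixed_fun_minus[OF assms(1), of "j *\<^sub>R y"]
    by (simp_all add: F_def)
  have D: "F (2 * i) (2 * j) = 8 * F i j" for i j
    using double[of "i *\<^sub>R x + j *\<^sub>R y"] by (simp add: F_def algebra_simps)
  \<comment> \<open>The instances are taken at (x - 2y, x + 2y) and (x + y, y - x). Homogeneity
    reduces all their terms to values at x, y, x +- y and x +- 2y. The first plus twice the second
    eliminates f(x - 2y) and leaves 96 times the cubic equation.\<close>
  have "F 1 2 - 3 * F 1 1 + 3 * F 1 0 - F 1 (- 1) = 6 * F 0 1"
    using E[of 1 1 "- 2" 2] E[of 1 "- 1" 1 1] D[of 1 2] D[of 1 "- 2"] D[of 1 1] D[of 1 "- 1"]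
      D[of 2 2] D[of 2 "- 2"] D[of 1 0] D[of 0 1] D[of 0 2]
    by (simp add: neg)
  then show "f (x + 2 *\<^sub>R y) - 3 *\<^sub>R f (x + y) + 3 *\<^sub>R f x - f (x - y) = 6 *\<^sub>R f y"
    by (simp add: F_def)
qed

lemma mixed_fun_imp_cubic:
  fixes f :: "'a::real_vector \<Rightarrow> real"
  assumes "mixed_fun f"
  shows "cubic_fun (\<lambda>x. f (2 *\<^sub>R x) - 2 * f x)"
proof (rule mixed_fun_homogeneous_imp_cubic)
  note E = assms[unfolded mixed_fun_def, rule_format]
  show "mixed_fun (\<lambda>x. f (2 *\<^sub>R x) - 2 * f x)"
    unfolding mixed_fun_def
  proof (intro allI)
    fix x y :: 'a
    show "3 *\<^sub>R (f (2 *\<^sub>R (x + 3 *\<^sub>R y)) - 2 * f (x + 3 *\<^sub>R y))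
        - (f (2 *\<^sub>R (3 *\<^sub>R x + y)) - 2 * f (3 *\<^sub>R x + y))
      = 12 *\<^sub>R (f (2 *\<^sub>R (x + y)) - 2 * f (x + y) + (f (2 *\<^sub>R (x - y)) - 2 * f (x - y)))
        - 16 *\<^sub>R (f (2 *\<^sub>R x) - 2 * f x + (f (2 *\<^sub>R y) - 2 * f y))
        + 12 *\<^sub>R (f (2 *\<^sub>R (2 *\<^sub>R y)) - 2 * f (2 *\<^sub>R y))
        - 4 *\<^sub>R (f (2 *\<^sub>R (2 *\<^sub>R x)) - 2 * f (2 *\<^sub>R x))"
      \<comment> \<open>The equation is linear in f and survives doubling of the arguments: subtract
        twice the instance at (x, y) from the one at (2x, 2y).\<close>
      using E[of x y] E[of "2 *\<^sub>R x" "2 *\<^sub>R y"]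
      by (simp add: scaleR_right_distrib scaleR_right_diff_distrib)
  qed
  show "f (2 *\<^sub>R (2 *\<^sub>R x)) - 2 * f (2 *\<^sub>R x) = 8 * (f (2 *\<^sub>R x) - 2 * f x)" for x
    using mixed_fun_imp_additive[OF assms, unfolded additive_fun_def, rule_format, of x x]
    by (simp flip: scaleR_2)
qed

section \<open>The decomposition of vector-valued solutions\<close>

theorem theorem2p3:
  fixes f :: "'a::real_vector \<Rightarrow> 'b::real_vector"
  shows "(\<forall>x y. 3 *\<^sub>R f (x + 3 *\<^sub>R y) - f (3 *\<^sub>R x + y)
            = 12 *\<^sub>R (f (x + y) + f (x - y)) - 16 *\<^sub>R (f x + f y)
              + 12 *\<^sub>R f (2 *\<^sub>R y) - 4 *\<^sub>R f (2 *\<^sub>R x))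
    \<longleftrightarrow> (\<exists>A H C G. additive_fun A \<and> additive_fun H \<and> cubic_fun C \<and> cubic_fun G
          \<and> (\<forall>x. H x = A (2 *\<^sub>R x) - 8 *\<^sub>R A x)
          \<and> (\<forall>x. G x = C (2 *\<^sub>R x) - 2 *\<^sub>R C x)
          \<and> (\<forall>x. f x = H x + G x))"
    (is "?mixed \<longleftrightarrow> ?decomposition")
proof
  assume ?decomposition
  then obtain H G where "additive_fun H" "cubic_fun G" and f_eq: "\<And>x. f x = H x + G x"
    by blast
  moreover from f_eq have f: "f = (\<lambda>x. H x + G x)"
    by (rule ext)
  ultimately have "mixed_fun f"
    unfolding f mixed_fun_iff_functionals[of "\<lambda>x. H x + G x"]
      additive_fun_iff_functionals[of H] cubic_fun_iff_functionals[of G]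
    by (simp add: linear_add mixed_fun_additive_plus_cubic)
  then show ?mixed
    by (simp add: mixed_fun_def)
next
  assume ?mixed
  then have "mixed_fun f"
    by (simp add: mixed_fun_def)
  then have mixed: "mixed_fun (\<lambda>x. \<phi> (f x))" if "linear \<phi>" for \<phi> :: "'b \<Rightarrow> real"
    using that mixed_fun_iff_functionals by blast
  define g where "g x = f (2 *\<^sub>R x) - 8 *\<^sub>R f x" for x
  define h where "h x = f (2 *\<^sub>R x) - 2 *\<^sub>R f x" for x
  have "additive_fun g"
    unfolding additive_fun_iff_functionals[of g] g_def
    by (simp add: linear_functional_simps mixed_fun_imp_additive[OF mixed])
  then have additive: "additive_fun (\<lambda>x. c *\<^sub>R g x)" for c
    by (simp add: additive_fun_def scaleR_right_distrib)
  have "cubic_fun h"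
    unfolding cubic_fun_iff_functionals[of h] h_def
    by (simp add: linear_functional_simps mixed_fun_imp_cubic[OF mixed])
  then have "cubic_fun (\<lambda>x. \<phi> (h x))" if "linear \<phi>" for \<phi> :: "'b \<Rightarrow> real"
    using that cubic_fun_iff_functionals by blast
  note double = cubic_fun_double[OF this]
  have cubic: "cubic_fun (\<lambda>x. c *\<^sub>R h x)" for c
    unfolding cubic_fun_def
  proof (intro allI)
    fix x y
    have "c *\<^sub>R (h (x + 2 *\<^sub>R y) - 3 *\<^sub>R h (x + y) + 3 *\<^sub>R h x - h (x - y)) = c *\<^sub>R (6 *\<^sub>R h y)"
      using \<open>cubic_fun h\<close> by (simp add: cubic_fun_def)
    then show "c *\<^sub>R h (x + 2 *\<^sub>R y) - 3 *\<^sub>R c *\<^sub>R h (x + y) + 3 *\<^sub>R c *\<^sub>R h x - c *\<^sub>R h (x - y)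
        = 6 *\<^sub>R c *\<^sub>R h y"
      by (simp add: algebra_simps)
  qed
  \<comment> \<open>Doubling the argument multiplies g by 2 and h by 8. Hence A(2x) - 8 A(x) = -6
    A(x) for a multiple A of g, and C(2x) - 2 C(x) = 6 C(x) for a multiple C of h. The required H =
    -g/6 and G = h/6 thus come from A = g/36 and C = h/36.\<close>
  have "(-1/6) *\<^sub>R g x = (1/36) *\<^sub>R g (2 *\<^sub>R x) - 8 *\<^sub>R (1/36) *\<^sub>R g x" for x
  proof -
    have "g (2 *\<^sub>R x) = 2 *\<^sub>R g x"
      using \<open>additive_fun g\<close> by (simp add: additive_fun_def scaleR_2)
    then show ?thesis
      by (simp flip: scaleR_left_diff_distrib)
  qed
  moreover have "(1/6) *\<^sub>R h x = (1/36) *\<^sub>R h (2 *\<^sub>R x) - 2 *\<^sub>R (1/36) *\<^sub>R h x" for x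
    by (rule eq_if_linear_functionals_eq) (simp add: linear_functional_simps double)
  moreover have "f x = (-1/6) *\<^sub>R g x + (1/6) *\<^sub>R h x" for x
    by (rule eq_if_linear_functionals_eq) (simp add: linear_functional_simps g_def h_def)
  ultimately show ?decomposition
    using additive[of "1/36"] additive[of "-1/6"] cubic[of "1/36"] cubic[of "1/6"]
    by (rule_tac x = "\<lambda>x. (1/36) *\<^sub>R g x" in exI,
        rule_tac x = "\<lambda>x. (-1/6) *\<^sub>R g x" in exI,
        rule_tac x = "\<lambda>x. (1/36) *\<^sub>R h x" in exI,
        rule_tac x = "\<lambda>x. (1/6) *\<^sub>R h x" in exI) (intro conjI allI)
qed

end
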